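(* Let $\phi$ be any symmetric gauge on $\mathbb{R}^n$, let $k\in\{1,\dots,n\}$, and let $\phi^{\langle k\rangle}$ be the associated rank-$k$ gauge defined in the context. Then, for $X\in\mathbb{S}^n$ with spectral decomposition $X=Q\Lambda(X)Q^\top$ ($Q$ orthogonal, $\Lambda(X)=\operatorname{diag}(\lambda(X))$), $$g_{\phi^{\langle k\rangle}}(X)=-\big(\phi^{\langle k\rangle}\big)^\circ(\lambda_-(X))=-\phi^\circ\big(\operatorname{trun}_k(\lambda_-(X))\big).$$ Moreover, there exists an optimal separator for $g_{\phi^{\langle k\rangle}}(X)$ (a minimizer $S^\star$ of the problem defining $g_{\phi^{\langle k\rangle}}(X)$) of the form $S^\star=Q\operatorname{diag}(z^\star)Q^\top$ with $$z^\star\in\operatorname{argmax}\{(\operatorname{trun}_k(\lambda_-(X)))^\top z:\ z\ge 0,\ \phi(z)\le 1,\ \operatorname{supp}(z)\subseteq\operatorname{supp}(\operatorname{trun}_k(\lambda_-(X)))\}.$$ In particular, $\operatorname{rank}(S^\star)\le k$. If $X\not\succeq 0$, then $\langle S^\star,X\rangle<0$ and the cut $\langle S^\star,Y\rangle\ge 0$ is valid (it holds for all $Y\in\mathbb{S}^n_+$).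
   Context: $\mathbb{S}^n$ is the space of real symmetric $n\times n$ matrices with the Frobenius inner product $\langle A,B\rangle=\operatorname{tr}(A^\top B)$; $\mathbb{S}^n_+$ is the cone of positive semidefinite matrices. For $X\in\mathbb{S}^n$, $\lambda(X)\in\mathbb{R}^n$ is the vector of eigenvalues in nondecreasing order, repeated with multiplicity, and $\lambda_-(X):=(\max\{-\lambda_i(X),0\})_{i}\in\mathbb{R}^n_+$. The support $\operatorname{supp}(u)$ of a vector is the set of indices of its nonzero components and $\|u\|_0:=|\operatorname{supp}(u)|$. A symmetric gauge on $\mathbb{R}^n$ is a norm $\psi$ with $\psi(z)=\psi(|z|)$ (componentwise absolute value) for all $z$ and $\psi(Pz)=\psi(z)$ for every permutation matrix $P$ and all $z$. The dual norm is $\psi^\circ(y)=\max\{|y^\top z|:\ \psi(z)\le 1\}$. For a symmetric gauge $\psi$, $\mathcal{B}_\psi:=\{S\in\mathbb{S}^n:\ \psi(\lambda(S))\le 1\}$ and $g_\psi(X):=\min_{S\in\mathbb{S}^n_+\cap\mathcal{B}_\psi}\langle S,X\rangle$. For a symmetric gauge $\phi$ and $k\in\{1,\dots,n\}$: $\mathcal{A}_k(\phi):=\{u\in\mathbb{R}^n:\ \phi(u)\le 1,\ \|u\|_0\le k\}$, $\mathcal{K}_k(\phi):=\operatorname{conv}(\mathcal{A}_k(\phi))$, and $\phi^{\langle k\rangle}(z):=\inf\{t>0:\ z\in t\,\mathcal{K}_k(\phi)\}$ for $z\in\mathbb{R}^n$; this is a symmetric gauge on $\mathbb{R}^n$. For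 $y\in\mathbb{R}^n$, $I_k(y)\subseteq\{1,\dots,n\}$ is an index set of $k$ largest entries of $|y|$, and $\operatorname{trun}_k(y):=\sum_{i\in I_k(y)}y_ie_i\in\mathbb{R}^n$, with $e_i$ the canonical basis vectors. *)

theory Defs
  imports "HOL-Analysis.Analysis" "HOL-Computational_Algebra.Polynomial"
begin

(* The index type 'n :: {finite, linorder} plays the role of {1, ..., n} with n = CARD('n);
   its linear order is what "eigenvalues in nondecreasing order" refers to. *)

definition sym_mats :: "(real ^ 'n ^ 'n) set" where
  "sym_mats = {A. transpose A = A}"

definition psd_cone :: "(real ^ 'n ^ 'n) set" where
  "psd_cone = {A \<in> sym_mats. \<forall>v. 0 \<le> v \<bullet> (A *v v)}"

definition frob :: "real ^ 'n ^ 'n \<Rightarrow> real ^ 'n ^ 'n \<Rightarrow> real" where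
  "frob A B = trace (transpose A ** B)"

definition diag_mat :: "real ^ 'n \<Rightarrow> real ^ 'n ^ 'n" where
  "diag_mat v = (\<chi> i j. if i = j then v $ i else 0)"

definition charpoly :: "real ^ 'n ^ 'n \<Rightarrow> real poly" where
  "charpoly A = det (\<chi> i j. (if i = j then [:0, 1:] else 0) - [:A $ i $ j:])"

(* Every real x occurs in the vector exactly as often as its multiplicity as a root of the
   characteristic polynomial. For symmetric A there is exactly one such vector; nothing is
   claimed for other A. *)
definition eigvals ::
    "real ^ 'n::{finite,linorder} ^ 'n::{finite,linorder}
      \<Rightarrow> real ^ 'n::{finite,linorder}" where
  "eigvals A = (THE v. (\<forall>i j. i \<le> j \<longrightarrow> v $ i \<le> v $ j) \<and>
                       (\<forall>x. card {i. v $ i = x} = order x (charpoly A)))"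

definition eigvals_neg ::
    "real ^ 'n::{finite,linorder} ^ 'n::{finite,linorder}
      \<Rightarrow> real ^ 'n::{finite,linorder}" where
  "eigvals_neg A = (\<chi> i. max (- (eigvals A $ i)) 0)"

definition supp :: "real ^ 'n \<Rightarrow> 'n set" where
  "supp u = {i. u $ i \<noteq> 0}"

definition is_norm :: "(real ^ 'n \<Rightarrow> real) \<Rightarrow> bool" where
  "is_norm \<psi> \<longleftrightarrow>
     (\<forall>z. 0 \<le> \<psi> z) \<and>
     (\<forall>z. \<psi> z = 0 \<longleftrightarrow> z = 0) \<and>
     (\<forall>c z. \<psi> (c *\<^sub>R z) = \<bar>c\<bar> * \<psi> z) \<and>
     (\<forall>y z. \<psi> (y + z) \<le> \<psi> y + \<psi> z)"

definition symmetric_gauge :: "(real ^ 'n \<Rightarrow> real) \<Rightarrow> bool" where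
  "symmetric_gauge \<psi> \<longleftrightarrow>
     is_norm \<psi> \<and>
     (\<forall>z. \<psi> z = \<psi> (\<chi> i. \<bar>z $ i\<bar>)) \<and>
     (\<forall>p z. p permutes UNIV \<longrightarrow> \<psi> (\<chi> i. z $ p i) = \<psi> z)"

(* GREATEST and LEAST denote an attained maximum and minimum. *)
definition dual_norm :: "(real ^ 'n \<Rightarrow> real) \<Rightarrow> real ^ 'n \<Rightarrow> real" where
  "dual_norm \<psi> y = (GREATEST t. t \<in> {\<bar>y \<bullet> z\<bar> |z. \<psi> z \<le> 1})"

definition spectral_ball ::
    "(real ^ 'n::{finite,linorder} \<Rightarrow> real)
      \<Rightarrow> (real ^ 'n::{finite,linorder} ^ 'n::{finite,linorder}) set" where
  "spectral_ball \<psi> = {S \<in> sym_mats. \<psi> (eigvals S) \<le> 1}"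

definition sep_value ::
    "(real ^ 'n::{finite,linorder} \<Rightarrow> real)
      \<Rightarrow> real ^ 'n::{finite,linorder} ^ 'n::{finite,linorder} \<Rightarrow> real" where
  "sep_value \<psi> X = (LEAST t. t \<in> {frob S X |S. S \<in> psd_cone \<inter> spectral_ball \<psi>})"

definition optimal_separator ::
    "(real ^ 'n::{finite,linorder} \<Rightarrow> real)
      \<Rightarrow> real ^ 'n::{finite,linorder} ^ 'n::{finite,linorder}
      \<Rightarrow> real ^ 'n::{finite,linorder} ^ 'n::{finite,linorder} \<Rightarrow> bool" where
  "optimal_separator \<psi> X S \<longleftrightarrow>
     is_arg_min (\<lambda>S. frob S X) (\<lambda>S. S \<in> psd_cone \<inter> spectral_ball \<psi>) S"

definition sparse_ball :: "nat \<Rightarrow> (real ^ 'n \<Rightarrow> real) \<Rightarrow> (real ^ 'n) set" where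
  "sparse_ball k \<phi> = {u. \<phi> u \<le> 1 \<and> card (supp u) \<le> k}"

definition rank_gauge :: "nat \<Rightarrow> (real ^ 'n \<Rightarrow> real) \<Rightarrow> real ^ 'n \<Rightarrow> real" where
  "rank_gauge k \<phi> z = Inf {t. 0 < t \<and> z \<in> (\<lambda>u. t *\<^sub>R u) ` (convex hull (sparse_ball k \<phi>))}"

(* Because of ties there may be several admissible index sets I_k(y). *)
definition top_index_set :: "nat \<Rightarrow> real ^ 'n \<Rightarrow> 'n set \<Rightarrow> bool" where
  "top_index_set k y I \<longleftrightarrow>
     card I = k \<and> (\<forall>i\<in>I. \<forall>j. j \<notin> I \<longrightarrow> \<bar>y $ j\<bar> \<le> \<bar>y $ i\<bar>)"

definition trun :: "'n set \<Rightarrow> real ^ 'n \<Rightarrow> real ^ 'n" where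
  "trun I y = (\<Sum>i\<in>I. y $ i *\<^sub>R axis i 1)"

end

theory Submission
  imports Defs "HOL-Combinatorics.Permutations"
begin

text \<open>
  Write \<open>y\<close> for the vector of negative parts of the eigenvalues of \<open>X\<close>, \<open>w\<close> for its
  truncation to \<open>I\<close>, \<open>a\<close> for the eigenvalues themselves, and let \<open>z\<close> maximize \<open>w \<bullet> z\<close> over the
  nonnegative part of the unit ball of \<open>\<phi>\<close> with support in that of \<open>w\<close>. Every value in the
  theorem, up to sign, is \<open>M = w \<bullet> z\<close>.

  Taking absolute values and deleting coordinates does not increase a symmetric gauge, so the
  restrictions on \<open>z\<close> cost nothing and \<open>M\<close> is the dual norm of \<open>w\<close> (\<open>gauge_ball_argmax\<close>).
  A linear functional that is bounded by \<open>M\<close> on the sparse ball is bounded by \<open>M\<close> times the rank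
  gauge (\<open>abs_inner_le_rank_gauge\<close>). The functional \<open>y\<close> is so bounded, because moving the mass of
  a \<open>k\<close>-sparse vector to the \<open>k\<close> largest entries of \<open>y\<close> only increases the pairing; as \<open>\<phi>\<close> is
  permutation invariant, so is each rearrangement of \<open>y\<close> (\<open>abs_inner_permuted_sparse_le\<close>). Since \<open>z\<close>
  is itself \<open>k\<close>-sparse, this bound is attained, and \<open>M\<close> is also the dual norm of \<open>y\<close> for the
  rank gauge.

  For the matrix problem, diagonalize a feasible \<open>S\<close> with eigenvalues \<open>s\<close>, all nonnegative. In the
  eigenbases of \<open>S\<close> and \<open>X\<close> the inner product of \<open>S\<close> and \<open>X\<close> is the sum of \<open>s\<^sub>i a\<^sub>j P\<^sub>i\<^sub>j\<close>, where
  \<open>P\<close>, the matrix of squared inner products of eigenvectors, is doubly stochastic. As \<open>a \<ge> - y\<close>, it is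
  at least minus the sum of \<open>s\<^sub>i y\<^sub>j P\<^sub>i\<^sub>j\<close>, which is at most the pairing of \<open>s\<close> with a
  rearrangement of \<open>y\<close> (\<open>frob_conj_diag_ge\<close>) and hence at most \<open>M\<close>. The matrix with eigenbasis \<open>Q\<close>
  and eigenvalues \<open>z\<close> attains \<open>- M\<close>, because \<open>a = - y\<close> wherever \<open>z\<close> is nonzero.

  The spectral theorem for real symmetric matrices is derived first; it also shows that the vector
  of eigenvalues, which is specified by the orders of the roots of the characteristic polynomial,
  is a rearrangement of the diagonal of any orthogonal diagonalization (\<open>eigvals_conj_diag\<close>).
\<close>

section \<open>The spectral theorem\<close>

text \<open>
  A maximizer of the Rayleigh quotient on the unit sphere of \<open>V\<close> is an eigenvector: the gradient
  of the quotient at a maximizer is orthogonal to \<open>V\<close>, and by invariance it also lies in \<open>V\<close>.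
\<close>

lemma selfadjoint_eigenvector_exists:
  fixes f :: "'a::euclidean_space \<Rightarrow> 'a"
  assumes lin: "linear f" and adj: "\<And>x y. x \<bullet> f y = f x \<bullet> y"
    and V: "subspace V" and inv: "f ` V \<subseteq> V" and ne: "\<exists>x\<in>V. x \<noteq> 0"
  shows "\<exists>v\<in>V. \<exists>c. norm v = 1 \<and> f v = c *\<^sub>R v"
proof -
  interpret linear f by (rule lin)
  let ?K = "sphere 0 1 \<inter> V"
  have "compact ?K"
    by (intro compact_Int_closed compact_sphere closed_subspace V)
  moreover have "?K \<noteq> {}"
  proof -
    obtain x where "x \<in> V" "x \<noteq> 0" using ne by blast
    then have "(1 / norm x) *\<^sub>R x \<in> ?K" using V by (simp add: subspace_mul)
    then show ?thesis by blast
  qed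
  moreover have "continuous_on ?K (\<lambda>x. x \<bullet> f x)"
    by (intro continuous_intros linear_continuous_on linear_conv_bounded_linear[THEN iffD1] lin)
  ultimately obtain v where v: "v \<in> ?K" and vmax: "\<And>x. x \<in> ?K \<Longrightarrow> x \<bullet> f x \<le> v \<bullet> f v"
    using continuous_attains_sup by metis
  define c where "c = v \<bullet> f v"
  have vV: "v \<in> V" and nv: "norm v = 1" using v by auto
  define g where "g w = c * (w \<bullet> w) - w \<bullet> f w" for w
  have g_nonneg: "0 \<le> g w" if "w \<in> V" for w
  proof (cases "w = 0")
    case False
    then have "(1 / norm w) *\<^sub>R w \<in> ?K" using that V by (simp add: subspace_mul)
    from vmax[OF this] have "(w \<bullet> f w) / (norm w)\<^sup>2 \<le> c"
      by (simp add: scale c_def power2_eq_square)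
    with False show ?thesis
      by (simp add: g_def field_simps power2_norm_eq_inner)
  qed (simp add: g_def zero)
  define e where "e = c *\<^sub>R v - f v"
  have eV: "e \<in> V"
    unfolding e_def using vV inv V by (intro subspace_diff subspace_mul) auto
  \<comment> \<open>The form \<open>g\<close> is nonnegative on \<open>V\<close> and vanishes at \<open>v\<close>, so its derivative at \<open>v\<close> vanishes there.\<close>
  have expand: "g (v + t *\<^sub>R e) = 2 * t * (e \<bullet> e) + t\<^sup>2 * g e" for t
  proof -
    have "g v = 0" using nv by (simp add: g_def c_def flip: power2_norm_eq_inner)
    moreover have "e \<bullet> f v = v \<bullet> f e" using adj[of v e] by (simp add: inner_commute)
    moreover have "c * (v \<bullet> e) = e \<bullet> e + v \<bullet> f e"
      by (simp add: e_def[THEN arg_cong[where f = "\<lambda>x. x \<bullet> e"]] inner_diff_left adj)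
    moreover have "g (v + t *\<^sub>R e) =
        g v + t * (2 * (c * (v \<bullet> e)) - v \<bullet> f e - e \<bullet> f v) + t\<^sup>2 * g e"
      by (simp add: g_def add scale inner_add_left inner_add_right algebra_simps
          power2_eq_square inner_commute[of e v])
    ultimately show ?thesis by simp
  qed
  have "e \<bullet> e = 0"
  proof (rule ccontr)
    assume "e \<bullet> e \<noteq> 0"
    then have pos: "e \<bullet> e > 0" by simp
    define t where "t = - (e \<bullet> e) / (g e + 1)"
    have ge: "0 \<le> g e" by (rule g_nonneg[OF eV])
    have "0 \<le> g (v + t *\<^sub>R e)"
      using vV eV V by (intro g_nonneg subspace_add subspace_mul)
    then have "0 \<le> t * (2 * (e \<bullet> e) + t * g e)"
      unfolding expand by (simp add: algebra_simps power2_eq_square)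
    moreover have "t < 0" using pos ge by (simp add: t_def field_simps)
    ultimately have "2 * (e \<bullet> e) + t * g e \<le> 0" by (simp add: zero_le_mult_iff)
    moreover have "t * g e \<ge> - (e \<bullet> e)"
      using pos ge by (simp add: t_def field_simps)
    ultimately show False using pos by linarith
  qed
  then have "f v = c *\<^sub>R v" by (simp add: e_def)
  with vV nv show ?thesis by blast
qed

text \<open>
  Among the orthonormal sets of eigenvectors take one of largest cardinality. The orthogonal
  complement of an invariant subspace is invariant, so if the set did not span, its complement would
  contain a further eigenvector.
\<close>

lemma selfadjoint_orthonormal_eigenbasis:
  fixes f :: "'a::euclidean_space \<Rightarrow> 'a"
  assumes lin: "linear f" and adj: "\<And>x y. x \<bullet> f y = f x \<bullet> y"
  shows "\<exists>B. pairwise orthogonal B \<and> (\<forall>b\<in>B. norm b = 1 \<and> (\<exists>c. f b = c *\<^sub>R b)) \<and>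
    finite B \<and> card B = DIM('a)"
proof -
  define good where "good B \<longleftrightarrow> pairwise orthogonal B \<and>
    (\<forall>b\<in>B. norm b = 1 \<and> (\<exists>c. f b = c *\<^sub>R b)) \<and> finite B" for B
  have bound: "independent B \<and> card B \<le> DIM('a)" if "good B" for B
  proof -
    have "independent B"
      using that by (intro pairwise_orthogonal_independent) (auto simp: good_def)
    then show ?thesis using independent_card_le by blast
  qed
  have "good {}" by (simp add: good_def)
  then obtain B where B: "good B" and Bmax: "\<And>C. good C \<Longrightarrow> card C \<le> card B"
    using ex_has_greatest_nat[of good "{}" card "Suc DIM('a)"] bound
    by (metis le_imp_less_Suc)
  have "card B = DIM('a)"
  proof (rule ccontr)
    assume "card B \<noteq> DIM('a)"
    with bound[OF B] have "span B \<noteq> UNIV"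
      by (metis dim_UNIV dim_eq_card dim_span)
    then have "dim B < DIM('a)"
      by (metis dim_eq_full dim_subset_UNIV le_neq_implies_less)
    then obtain x where x: "x \<noteq> 0" "\<And>y. y \<in> span B \<Longrightarrow> orthogonal x y"
      using orthogonal_to_subspace_exists by metis
    define V where "V = {w. \<forall>b\<in>B. b \<bullet> w = 0}"
    have "subspace V" by (auto simp: V_def subspace_def inner_add_right)
    moreover have "f ` V \<subseteq> V"
    proof clarify
      fix w assume w: "w \<in> V"
      show "f w \<in> V" unfolding V_def
      proof clarify
        fix b assume b: "b \<in> B"
        then obtain c where "f b = c *\<^sub>R b" using B by (auto simp: good_def)
        then show "b \<bullet> f w = 0" using w b by (simp add: adj V_def)
      qed
    qed
    moreover have "x \<in> V"
      using x(2) by (auto simp: V_def orthogonal_def inner_commute span_base)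
    ultimately obtain v c where v: "v \<in> V" "norm v = 1" "f v = c *\<^sub>R v"
      using selfadjoint_eigenvector_exists[OF lin adj] x(1) by metis
    have "v \<notin> B" using v by (auto simp: V_def)
    moreover have "good (insert v B)"
      using B v by (auto simp: good_def pairwise_insert orthogonal_def V_def inner_commute)
    ultimately show False
      using Bmax[of "insert v B"] B by (auto simp: good_def)
  qed
  with B show ?thesis unfolding good_def by blast
qed

lemma matrix_mult_diag_nth:
  "(A ** diag_mat d) $ i $ j = A $ i $ j * d $ j"
  by (simp add: matrix_matrix_mult_def diag_mat_def if_distrib sum.delta cong: if_cong)

lemma conj_diag_nth:
  "(Q ** diag_mat d ** transpose Q) $ i $ j = (\<Sum>l\<in>UNIV. d $ l * Q $ i $ l * Q $ j $ l)"
  by (simp add: matrix_mult_diag_nth matrix_matrix_mult_def[of "Q ** diag_mat d"] transpose_def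
      mult_ac)

theorem symmetric_matrix_diagonalizable:
  fixes A :: "real ^ 'n ^ 'n"
  assumes "A \<in> sym_mats"
  shows "\<exists>R d. orthogonal_matrix R \<and> A = R ** diag_mat d ** transpose R"
proof -
  have AT: "transpose A = A" using assms by (simp add: sym_mats_def)
  have "x \<bullet> (A *v y) = (A *v x) \<bullet> y" for x y
    by (metis AT dot_lmul_matrix vector_transpose_matrix)
  from selfadjoint_orthonormal_eigenbasis[OF matrix_vector_mul_linear this]
  obtain B where B: "pairwise orthogonal B" "finite B" "card B = CARD('n)"
    and eig: "\<And>b. b \<in> B \<Longrightarrow> norm b = 1 \<and> (\<exists>c. A *v b = c *\<^sub>R b)"
    by auto
  obtain h where h: "bij_betw h (UNIV :: 'n set) B"
    using B finite_same_card_bij[of "UNIV :: 'n set" B] by auto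
  then have hB: "h i \<in> B" for i by (auto simp: bij_betw_def)
  have "\<forall>i. \<exists>c. A *v h i = c *\<^sub>R h i" using eig hB by blast
  then obtain c where c: "\<And>i. A *v h i = c i *\<^sub>R h i" by metis
  define R where "R = (\<chi> i j. h j $ i)"
  define d where "d = (\<chi> i. c i)"
  have col: "column j R = h j" for j by (simp add: column_def R_def vec_eq_iff)
  have orth: "orthogonal_matrix R"
    unfolding orthogonal_matrix_orthonormal_columns col
    using B(1) h hB eig unfolding pairwise_def bij_betw_def by (metis UNIV_I inj_on_eq_iff)
  have "A ** R = R ** diag_mat d"
  proof -
    have "(A ** R) $ i $ j = (A *v h j) $ i" for i j
      by (simp add: matrix_matrix_mult_def matrix_vector_mult_def R_def)
    then show ?thesis
      by (simp add: vec_eq_iff matrix_mult_diag_nth c d_def) (simp add: R_def)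
  qed
  then have "A = R ** diag_mat d ** transpose R"
    using orth by (metis matrix_mul_assoc matrix_mul_rid orthogonal_matrix_def)
  with orth show ?thesis by blast
qed

section \<open>The sorted eigenvalue vector\<close>

text \<open>
  Conjugation by \<open>Q\<close>, lifted to matrices of constant polynomials, does not change the determinant.
\<close>

lemma charpoly_conj_diag:
  fixes Q :: "real ^ 'n ^ 'n"
  assumes "orthogonal_matrix Q"
  shows "charpoly (Q ** diag_mat d ** transpose Q) = (\<Prod>i\<in>UNIV. [:- d $ i, 1:])"
proof -
  define C :: "real ^ 'n ^ 'n \<Rightarrow> real poly ^ 'n ^ 'n" where "C M = (\<chi> i j. [:M $ i $ j:])" for M
  have C_mult: "C M ** C N = C (M ** N)" for M N
    by (simp add: C_def vec_eq_iff matrix_matrix_mult_def sum_to_poly mult.commute)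
  have C_id: "C (mat 1) = mat 1"
    by (simp add: C_def vec_eq_iff mat_def)
  define L :: "real poly ^ 'n ^ 'n" where "L = (\<chi> i j. if i = j then [:- d $ i, 1:] else 0)"
  have QQ: "Q ** transpose Q = mat 1" using assms by (simp add: orthogonal_matrix_def)
  have entry: "(C Q ** L ** C (transpose Q)) $ i $ j =
      (if i = j then [:0, 1:] else 0) - [:(Q ** diag_mat d ** transpose Q) $ i $ j:]" for i j
  proof -
    have "(C Q ** L) $ i $ l = [:Q $ i $ l:] * [:- d $ l, 1:]" for i l
      by (simp add: matrix_matrix_mult_def C_def L_def if_distrib sum.delta cong: if_cong)
    then have "(C Q ** L ** C (transpose Q)) $ i $ j =
        (\<Sum>l\<in>UNIV. [:Q $ i $ l:] * [:- d $ l, 1:] * [:Q $ j $ l:])"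
      by (simp add: matrix_matrix_mult_def[of "C Q ** L"]) (simp add: C_def transpose_def mult_ac)
    also have "\<dots> = (\<Sum>l\<in>UNIV. [:0, 1:] * [:Q $ i $ l * Q $ j $ l:] - [:d $ l * Q $ i $ l * Q $ j $ l:])"
      by (intro sum.cong) (auto simp: mult_ac)
    also have "\<dots> = [:0, 1:] * [:\<Sum>l\<in>UNIV. Q $ i $ l * Q $ j $ l:]
        - [:\<Sum>l\<in>UNIV. d $ l * Q $ i $ l * Q $ j $ l:]"
      by (simp only: sum_subtractf sum_distrib_left[symmetric])
        (simp add: sum_to_poly)
    also have "(\<Sum>l\<in>UNIV. Q $ i $ l * Q $ j $ l) = (Q ** transpose Q) $ i $ j"
      by (simp add: matrix_matrix_mult_def transpose_def)
    finally show ?thesis by (simp add: QQ mat_def conj_diag_nth)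
  qed
  have "charpoly (Q ** diag_mat d ** transpose Q) = det (C Q ** L ** C (transpose Q))"
    unfolding charpoly_def by (rule arg_cong[where f = det]) (simp add: vec_eq_iff entry)
  also have "\<dots> = det (C Q ** C (transpose Q)) * det L"
    by (simp add: det_mul mult_ac)
  also have "\<dots> = det L" by (simp add: C_mult QQ C_id)
  also have "\<dots> = (\<Prod>i\<in>UNIV. [:- d $ i, 1:])"
    by (subst det_diagonal) (simp_all add: L_def)
  finally show ?thesis .
qed

lemma order_prod_linear_factors:
  fixes d :: "'a \<Rightarrow> real"
  assumes "finite A"
  shows "order x (\<Prod>i\<in>A. [:- d i, 1:]) = card {i \<in> A. d i = x}"
  using assms
proof (induction A)
  case (insert a A)
  have "order x (\<Prod>i\<in>insert a A. [:- d i, 1:]) =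
      order x [:- d a, 1:] + card {i \<in> A. d i = x}"
    using insert by (simp add: order_mult del: mult_pCons_left)
  moreover have "order x [:- d a, 1:] = (if d a = x then 1 else 0)"
    using order_power_n_n[of x 1] by (auto intro: order_0I)
  moreover have "{i \<in> insert a A. d i = x} =
      (if d a = x then insert a {i \<in> A. d i = x} else {i \<in> A. d i = x})"
    by auto
  ultimately show ?case using insert by simp
qed simp

lemma image_mset_eqI_card_fibres:
  fixes f g :: "'a::finite \<Rightarrow> 'b"
  assumes "\<And>x. card {i. f i = x} = card {i. g i = x}"
  shows "image_mset f (mset_set UNIV) = image_mset g (mset_set UNIV)"
  using assms by (intro multiset_eqI) (simp add: count_image_mset vimage_def)

text \<open>
  If \<open>v\<close> were smaller than \<open>w\<close> at \<open>i\<close>, then all indices up to \<open>i\<close> would have \<open>v\<close>-values at most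
  \<open>v $ i\<close>, but only indices strictly below \<open>i\<close> could have such \<open>w\<close>-values; equal fibres forbid this
  difference in number.
\<close>

lemma sorted_vec_eqI:
  fixes v w :: "real ^ 'n::{finite,linorder}"
  assumes v: "\<forall>i j. i \<le> j \<longrightarrow> v $ i \<le> v $ j" and w: "\<forall>i j. i \<le> j \<longrightarrow> w $ i \<le> w $ j"
    and eq: "\<And>x. card {i. v $ i = x} = card {i. w $ i = x}"
  shows "v = w"
proof -
  have le: "w $ i \<le> v $ i"
    if v: "\<forall>i j. i \<le> j \<longrightarrow> v $ i \<le> v $ j" and w: "\<forall>i j. i \<le> j \<longrightarrow> w $ i \<le> w $ j"
      and eq: "\<And>x. card {i. v $ i = x} = card {i. w $ i = x}"
    for v w :: "real ^ 'n::{finite,linorder}" and i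
  proof (rule ccontr)
    assume less: "\<not> w $ i \<le> v $ i"
    have "image_mset (($) v) (mset_set UNIV) = image_mset (($) w) (mset_set UNIV)"
      by (rule image_mset_eqI_card_fibres) (rule eq)
    then have "size (filter_mset (\<lambda>x. x \<le> v $ i) (image_mset (($) v) (mset_set UNIV)))
      = size (filter_mset (\<lambda>x. x \<le> v $ i) (image_mset (($) w) (mset_set UNIV)))"
      by simp
    then have card_eq: "card {j. v $ j \<le> v $ i} = card {j. w $ j \<le> v $ i}"
      by (simp add: filter_mset_image_mset)
    have "{j. w $ j \<le> v $ i} \<subseteq> {..<i}" using w less by (force simp: not_le[symmetric])
    then have "card {j. w $ j \<le> v $ i} \<le> card {..<i}" by (intro card_mono) auto
    also have "\<dots> < card {..i}" by (intro psubset_card_mono) auto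
    also have "\<dots> \<le> card {j. v $ j \<le> v $ i}" using v by (intro card_mono) auto
    finally show False using card_eq by simp
  qed
  show ?thesis
    unfolding vec_eq_iff using le[OF v w eq] le[OF w v eq[symmetric]] by (auto intro: antisym)
qed

lemma sorting_permutation_exists:
  fixes d :: "'n::{finite,linorder} \<Rightarrow> real"
  shows "\<exists>p. p permutes UNIV \<and> (\<forall>i j. i \<le> j \<longrightarrow> d (p i) \<le> d (p j))"
proof -
  \<comment> \<open>The rank \<open>r\<close> identifies the index type with an initial segment of the natural numbers, where
    lists can be sorted.\<close>
  define r where "r i = card {..<i}" for i :: 'n
  have r_less: "r i < r j" if "i < j" for i j
    unfolding r_def using that by (intro psubset_card_mono) auto
  have "inj r" by (rule linorder_injI) (use r_less in \<open>auto simp: less_imp_neq\<close>)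
  moreover have rN: "r i < CARD('n)" for i
    unfolding r_def by (intro psubset_card_mono) auto
  ultimately have r_range: "range r = {..<CARD('n)}"
    by (intro card_subset_eq) (auto simp: card_image)
  define L where "L = sorted_list_of_multiset (image_mset d (mset_set UNIV))"
  have mset_L: "mset L = image_mset d (mset_set UNIV)" by (simp add: L_def)
  then have len: "length L = CARD('n)" by (metis size_image_mset size_mset size_mset_set)
  have "image_mset (\<lambda>i. L ! r i) (mset_set UNIV) = image_mset ((!) L) (image_mset r (mset_set UNIV))"
    by (simp add: image_mset.compositionality comp_def)
  also have "\<dots> = image_mset ((!) L) (mset_set {..<length L})"
    using image_mset_mset_set[OF \<open>inj r\<close>] by (simp add: r_range len)
  also have "\<dots> = mset L" by (metis map_nth mset_map mset_upt lessThan_atLeast0)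
  also note mset_L
  finally obtain p where p: "p permutes (UNIV :: 'n set)" "\<And>i. L ! r i = d (p i)"
    using image_mset_eq_implies_permutes[of "UNIV :: 'n set" "\<lambda>i. L ! r i" d] by auto
  have "L ! r i \<le> L ! r j" if "i \<le> j" for i j
    using r_less[of i j] that rN len
    by (intro sorted_nth_mono) (auto simp: L_def sorted_sorted_list_of_multiset le_less)
  with p show ?thesis by auto
qed

text \<open>
  The order of a number as a root of the characteristic polynomial is the number of times it
  occurs in \<open>d\<close>, so sorting \<open>d\<close> gives the one vector that the description of the eigenvalues allows.
\<close>

lemma eigvals_conj_diag:
  fixes Q :: "real ^ 'n::{finite,linorder} ^ 'n::{finite,linorder}"
  assumes Q: "orthogonal_matrix Q"
  shows "\<exists>p. p permutes UNIV \<and> eigvals (Q ** diag_mat d ** transpose Q) = (\<chi> i. d $ p i)"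
proof -
  let ?A = "Q ** diag_mat d ** transpose Q"
  obtain p where p: "p permutes (UNIV :: 'n set)" "\<forall>i j. i \<le> j \<longrightarrow> d $ p i \<le> d $ p j"
    using sorting_permutation_exists[of "($) d"] by auto
  let ?v = "\<chi> i. d $ p i"
  have order: "order x (charpoly ?A) = card {i. d $ i = x}" for x
    by (simp add: charpoly_conj_diag[OF Q] order_prod_linear_factors)
  have "{i. d $ p i = x} = inv p ` {i. d $ i = x}" for x
    using p(1) by (auto simp: permutes_inverses image_iff) (metis p(1) permutes_inverses(2))
  then have card_v: "card {i. ?v $ i = x} = order x (charpoly ?A)" for x
    using permutes_inj[OF permutes_inv[OF p(1)]]
    by (simp add: order card_image inj_on_subset)
  have "eigvals ?A = ?v"
    unfolding eigvals_def
  proof (rule the_equality)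
    show "(\<forall>i j. i \<le> j \<longrightarrow> ?v $ i \<le> ?v $ j) \<and> (\<forall>x. card {i. ?v $ i = x} = order x (charpoly ?A))"
      using p(2) card_v by simp
  next
    fix w :: "real ^ 'n::{finite,linorder}"
    assume "(\<forall>i j. i \<le> j \<longrightarrow> w $ i \<le> w $ j) \<and> (\<forall>x. card {i. w $ i = x} = order x (charpoly ?A))"
    then show "w = ?v"
      using p(2) card_v by (intro sorted_vec_eqI) auto
  qed
  with p(1) show ?thesis by blast
qed

corollary spectral_decomposition_eigvals:
  fixes S :: "real ^ 'n::{finite,linorder} ^ 'n::{finite,linorder}"
  assumes "S \<in> sym_mats"
  shows "\<exists>R d p. orthogonal_matrix R \<and> S = R ** diag_mat d ** transpose R \<and>
    p permutes UNIV \<and> eigvals S = (\<chi> i. d $ p i)"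
  using symmetric_matrix_diagonalizable[OF assms] eigvals_conj_diag by metis


section \<open>Traces of products and doubly stochastic matrices\<close>

lemma frob_eq_sum: "frob A B = (\<Sum>i\<in>UNIV. \<Sum>j\<in>UNIV. A $ i $ j * B $ i $ j)"
  by (simp add: frob_def trace_def matrix_matrix_mult_def transpose_def) (rule sum.swap)

lemma frob_conj_diag:
  "frob (R ** diag_mat s ** transpose R) X = (\<Sum>l\<in>UNIV. s $ l * (column l R \<bullet> (X *v column l R)))"
proof -
  have "frob (R ** diag_mat s ** transpose R) X =
      (\<Sum>i\<in>UNIV. \<Sum>j\<in>UNIV. \<Sum>l\<in>UNIV. s $ l * R $ i $ l * R $ j $ l * X $ i $ j)"
    by (simp add: frob_eq_sum conj_diag_nth sum_distrib_right)
  also have "\<dots> = (\<Sum>l\<in>UNIV. \<Sum>i\<in>UNIV. \<Sum>j\<in>UNIV. s $ l * R $ i $ l * R $ j $ l * X $ i $ j)"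
    by (subst (2) sum.swap, subst sum.swap) (rule refl)
  also have "\<dots> = (\<Sum>l\<in>UNIV. s $ l * (column l R \<bullet> (X *v column l R)))"
    by (simp add: inner_vec_def matrix_vector_mult_def column_def sum_distrib_left mult_ac)
  finally show ?thesis .
qed

lemma quadratic_form_conj_diag:
  "v \<bullet> ((Q ** diag_mat a ** transpose Q) *v v) = (\<Sum>l\<in>UNIV. a $ l * (column l Q \<bullet> v)\<^sup>2)"
proof -
  have "v \<bullet> ((Q ** diag_mat a ** transpose Q) *v v) =
      (\<Sum>i\<in>UNIV. \<Sum>j\<in>UNIV. \<Sum>l\<in>UNIV. a $ l * Q $ i $ l * Q $ j $ l * v $ i * v $ j)"
    by (simp add: inner_vec_def matrix_vector_mult_def conj_diag_nth
        sum_distrib_left sum_distrib_right mult_ac)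
  also have "\<dots> = (\<Sum>l\<in>UNIV. \<Sum>i\<in>UNIV. \<Sum>j\<in>UNIV. a $ l * Q $ i $ l * Q $ j $ l * v $ i * v $ j)"
    by (subst (2) sum.swap, subst sum.swap) (rule refl)
  also have "\<dots> = (\<Sum>l\<in>UNIV. a $ l * (column l Q \<bullet> v)\<^sup>2)"
    by (simp add: inner_vec_def column_def power2_eq_square sum_product sum_distrib_left mult_ac)
  finally show ?thesis .
qed

lemma inner_columns_orthogonal_matrix:
  fixes Q :: "real ^ 'n ^ 'n"
  assumes "orthogonal_matrix Q"
  shows "column i Q \<bullet> column j Q = (if i = j then 1 else 0)"
proof -
  have "(transpose Q ** Q) $ i $ j = column i Q \<bullet> column j Q"
    by (simp add: matrix_matrix_mult_def transpose_def column_def inner_vec_def)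
  then show ?thesis using assms by (simp add: orthogonal_matrix_def mat_def)
qed

lemma sum_inner_columns_squared:
  fixes Q :: "real ^ 'n ^ 'n"
  assumes "orthogonal_matrix Q"
  shows "(\<Sum>l\<in>UNIV. (column l Q \<bullet> v)\<^sup>2) = v \<bullet> v"
proof -
  have "Q ** diag_mat (\<chi> l. 1) ** transpose Q = mat 1"
  proof -
    have "diag_mat (\<chi> l. 1) = (mat 1 :: real ^ 'n ^ 'n)"
      by (simp add: vec_eq_iff diag_mat_def mat_def)
    then show ?thesis using assms by (simp add: orthogonal_matrix_def)
  qed
  then show ?thesis
    using quadratic_form_conj_diag[of v Q "\<chi> l. 1"] by simp
qed

lemma conj_diag_in_sym_mats: "Q ** diag_mat d ** transpose Q \<in> sym_mats"
  by (simp add: sym_mats_def vec_eq_iff transpose_def[of "Q ** diag_mat d ** transpose Q"]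
      conj_diag_nth mult_ac)

lemma conj_diag_in_psd_cone_iff:
  fixes Q :: "real ^ 'n ^ 'n"
  assumes "orthogonal_matrix Q"
  shows "Q ** diag_mat d ** transpose Q \<in> psd_cone \<longleftrightarrow> (\<forall>i. 0 \<le> d $ i)"
proof
  assume psd: "Q ** diag_mat d ** transpose Q \<in> psd_cone"
  show "\<forall>i. 0 \<le> d $ i"
  proof
    fix i
    have "column i Q \<bullet> ((Q ** diag_mat d ** transpose Q) *v column i Q) = d $ i"
      unfolding quadratic_form_conj_diag inner_columns_orthogonal_matrix[OF assms]
      by (simp add: if_distrib[of "\<lambda>x. x\<^sup>2"] if_distrib[of "\<lambda>x. _ * x"] cong: if_cong)
    then show "0 \<le> d $ i" using psd by (simp add: psd_cone_def) metis
  qed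
next
  assume "\<forall>i. 0 \<le> d $ i"
  then show "Q ** diag_mat d ** transpose Q \<in> psd_cone"
    by (simp add: psd_cone_def conj_diag_in_sym_mats quadratic_form_conj_diag sum_nonneg)
qed

lemma frob_psd_nonneg:
  fixes Q :: "real ^ 'n ^ 'n"
  assumes "\<forall>i. 0 \<le> z $ i" and "Y \<in> psd_cone"
  shows "0 \<le> frob (Q ** diag_mat z ** transpose Q) Y"
  using assms by (simp add: frob_conj_diag psd_cone_def sum_nonneg)

lemma rank_conj_diag_le:
  fixes Q :: "real ^ 'n ^ 'n"
  shows "rank (Q ** diag_mat z ** transpose Q) \<le> card (supp z)"
proof -
  have "rank (Q ** diag_mat z ** transpose Q) \<le> rank (Q ** diag_mat z)"
    by (rule rank_mul_le_left)
  also have "\<dots> \<le> rank (diag_mat z)" by (rule rank_mul_le_right)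
  also have "\<dots> \<le> card ((\<lambda>i. axis i 1 :: real ^ 'n) ` supp z)"
    unfolding row_rank_def
  proof (rule dim_le_card)
    have "row i (diag_mat z) = z $ i *\<^sub>R axis i 1" for i
      by (simp add: row_def diag_mat_def axis_def vec_eq_iff)
    then show "rows (diag_mat z) \<subseteq> span ((\<lambda>i. axis i 1) ` supp z)"
      by (auto simp: rows_def supp_def intro: span_mul span_base)
        (metis (mono_tags, lifting) imageI mem_Collect_eq scale_eq_0_iff span_base span_scale span_zero)
  qed simp
  also have "\<dots> \<le> card (supp z)" by (rule card_image_le) simp
  finally show ?thesis .
qed

text \<open>
  Summation by parts, as an induction that adds the smallest index last: the constant \<open>c\<close> is left
  free so that the induction hypothesis can be used with the next value of \<open>s\<close> in its place.
\<close>

lemma sum_mult_ge_if_upper_sums_nonneg: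
  fixes s d :: "'a::linorder \<Rightarrow> real"
  assumes "finite A"
    and "\<And>i j. i \<in> A \<Longrightarrow> j \<in> A \<Longrightarrow> i \<le> j \<Longrightarrow> s i \<le> s j"
    and "\<And>m. m \<in> A \<Longrightarrow> 0 \<le> sum d {i \<in> A. m \<le> i}"
    and "\<And>i. i \<in> A \<Longrightarrow> c \<le> s i"
  shows "c * sum d A \<le> (\<Sum>i\<in>A. s i * d i)"
  using assms
proof (induction A arbitrary: c rule: finite_linorder_min_induct)
  case (insert b A)
  have b: "b \<notin> A" using insert.hyps by auto
  have "{i \<in> insert b A. m \<le> i} = {i \<in> A. m \<le> i}" if "m \<in> A" for m
    using insert.hyps that by auto
  then have "s b * sum d A \<le> (\<Sum>i\<in>A. s i * d i)"
    using insert.prems insert.hyps by (intro insert.IH) (simp_all add: less_imp_le, metis insertI2)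
  moreover have "{i \<in> insert b A. b \<le> i} = insert b A"
    using insert.hyps by (auto simp: less_imp_le)
  then have "0 \<le> sum d (insert b A)" using insert.prems(2)[of b] by simp
  then have "c * sum d (insert b A) \<le> s b * sum d (insert b A)"
    using insert.prems(3)[of b] by (intro mult_right_mono) auto
  ultimately show ?case using b insert.hyps by (simp add: algebra_simps)
qed simp

text \<open>
  By summation by parts it suffices that averaging with \<open>P\<close> does not increase the sum of \<open>t\<close>
  over any upper set \<open>U\<close>. The averaged sum weighs the entries of \<open>t\<close> with weights in \<open>[0, 1]\<close> of
  total \<open>card U\<close>, and such a weighting is largest when it is concentrated on the top entries.
\<close>

lemma doubly_stochastic_le_sorted_sum:
  fixes P :: "'n::{finite,linorder} \<Rightarrow> 'n \<Rightarrow> real" and s t :: "'n \<Rightarrow> real"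
  assumes nonneg: "\<And>i j. 0 \<le> P i j"
    and rows: "\<And>i. (\<Sum>j\<in>UNIV. P i j) = 1" and cols: "\<And>j. (\<Sum>i\<in>UNIV. P i j) = 1"
    and s: "\<And>i j. i \<le> j \<Longrightarrow> s i \<le> s j" and t: "\<And>i j. i \<le> j \<Longrightarrow> t i \<le> t j"
  shows "(\<Sum>i\<in>UNIV. \<Sum>j\<in>UNIV. s i * t j * P i j) \<le> (\<Sum>i\<in>UNIV. s i * t i)"
proof -
  define d where "d i = t i - (\<Sum>j\<in>UNIV. t j * P i j)" for i
  have sum_d: "sum d U = (\<Sum>j\<in>UNIV. ((if j \<in> U then 1 else 0) - (\<Sum>i\<in>U. P i j)) * t j)" for U
  proof -
    have "sum d U = sum t U - (\<Sum>j\<in>UNIV. (\<Sum>i\<in>U. P i j) * t j)"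
      unfolding d_def sum_subtractf sum_distrib_right by (subst sum.swap) (simp add: mult.commute)
    moreover have "sum t U = (\<Sum>j\<in>UNIV. (if j \<in> U then 1 else 0) * t j)"
      by (simp add: if_distrib[of "\<lambda>x. x * _"] sum.If_cases cong: if_cong)
    ultimately show ?thesis by (simp add: sum_subtractf left_diff_distrib)
  qed
  have upper: "0 \<le> sum d {i \<in> UNIV. m \<le> i}" for m
  proof -
    let ?U = "{i. m \<le> i}"
    let ?w = "\<lambda>j. (if j \<in> ?U then 1 else 0) - (\<Sum>i\<in>?U. P i j)"
    have "?w j * t m \<le> ?w j * t j" for j
    proof (cases "j \<in> ?U")
      case True
      have "(\<Sum>i\<in>?U. P i j) \<le> (\<Sum>i\<in>UNIV. P i j)" using nonneg by (intro sum_mono2) auto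
      with True show ?thesis using t by (intro mult_left_mono) (auto simp: cols)
    next
      case False
      then show ?thesis using t nonneg by (intro mult_left_mono_neg) (auto intro: sum_nonneg)
    qed
    then have "(\<Sum>j\<in>UNIV. ?w j * t m) \<le> sum d ?U" unfolding sum_d by (rule sum_mono)
    moreover have "(\<Sum>j\<in>UNIV. ?w j) = 0"
    proof -
      have "(\<Sum>j\<in>UNIV. \<Sum>i\<in>?U. P i j) = card ?U"
        by (subst sum.swap) (simp add: rows)
      then show ?thesis by (simp add: sum_subtractf sum.If_cases)
    qed
    then have "(\<Sum>j\<in>UNIV. ?w j * t m) = 0" by (simp only: sum_distrib_right[symmetric])
    ultimately show ?thesis by simp
  qed
  have "s (Min UNIV) * sum d UNIV \<le> (\<Sum>i\<in>UNIV. s i * d i)"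
    using upper s by (intro sum_mult_ge_if_upper_sums_nonneg) auto
  moreover have "sum d UNIV = 0" by (simp add: sum_d cols)
  moreover have "(\<Sum>i\<in>UNIV. s i * d i) =
      (\<Sum>i\<in>UNIV. s i * t i) - (\<Sum>i\<in>UNIV. \<Sum>j\<in>UNIV. s i * t j * P i j)"
    by (simp add: d_def right_diff_distrib sum_subtractf sum_distrib_left mult.assoc)
  ultimately show ?thesis by simp
qed

text \<open>
  This is what one would deduce from Birkhoff's theorem that permutation matrices are the extreme
  points of the doubly stochastic ones; sorting both vectors gives the permutation directly.
\<close>

lemma doubly_stochastic_le_permutation:
  fixes P :: "'n::{finite,linorder} \<Rightarrow> 'n \<Rightarrow> real" and s t :: "'n \<Rightarrow> real"
  assumes nonneg: "\<And>i j. 0 \<le> P i j"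
    and rows: "\<And>i. (\<Sum>j\<in>UNIV. P i j) = 1" and cols: "\<And>j. (\<Sum>i\<in>UNIV. P i j) = 1"
  shows "\<exists>p. p permutes UNIV \<and>
    (\<Sum>i\<in>UNIV. \<Sum>j\<in>UNIV. s i * t j * P i j) \<le> (\<Sum>i\<in>UNIV. s i * t (p i))"
proof -
  obtain p where p: "p permutes (UNIV :: 'n set)" "\<forall>i j. i \<le> j \<longrightarrow> s (p i) \<le> s (p j)"
    using sorting_permutation_exists by blast
  obtain q where q: "q permutes (UNIV :: 'n set)" "\<forall>i j. i \<le> j \<longrightarrow> t (q i) \<le> t (q j)"
    using sorting_permutation_exists by blast
  note reindex_p = sum.permute[OF p(1), unfolded comp_def]
  note reindex_q = sum.permute[OF q(1), unfolded comp_def]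
  have "(\<Sum>i\<in>UNIV. \<Sum>j\<in>UNIV. s i * t j * P i j) =
      (\<Sum>i\<in>UNIV. \<Sum>j\<in>UNIV. s (p i) * t (q j) * P (p i) (q j))"
    by (subst reindex_p) (subst reindex_q, rule refl)
  also have "\<dots> \<le> (\<Sum>i\<in>UNIV. s (p i) * t (q i))"
    using p(2) q(2) nonneg rows cols
    by (intro doubly_stochastic_le_sorted_sum)
      (simp_all flip: reindex_p[of "\<lambda>i. P i (q _)"] reindex_q[of "P (p _)"])
  also have "\<dots> = (\<Sum>i\<in>UNIV. s i * t (q (inv p i)))"
    using reindex_p[of "\<lambda>i. s i * t (q (inv p i))"] permutes_inverses(2)[OF p(1)] by simp
  finally show ?thesis
    using permutes_compose[OF permutes_inv[OF p(1)] q(1)] by (auto simp: comp_def)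
qed

text \<open>
  A one-sided form of von Neumann's trace inequality. The squared inner products of the columns of
  two orthogonal matrices form a doubly stochastic matrix by Parseval's identity.
\<close>

lemma frob_conj_diag_ge:
  fixes R Q :: "real ^ 'n::{finite,linorder} ^ 'n::{finite,linorder}"
  assumes R: "orthogonal_matrix R" and Q: "orthogonal_matrix Q"
    and s: "\<forall>i. 0 \<le> s $ i" and y: "\<forall>i. - y $ i \<le> a $ i"
  shows "\<exists>p. p permutes UNIV \<and>
    - (\<Sum>i\<in>UNIV. s $ i * y $ p i) \<le> frob (R ** diag_mat s ** transpose R) (Q ** diag_mat a ** transpose Q)"
proof -
  define P where "P i j = (column j Q \<bullet> column i R)\<^sup>2" for i j
  have "(\<Sum>j\<in>UNIV. P i j) = 1" for i
    by (simp add: P_def sum_inner_columns_squared[OF Q] inner_columns_orthogonal_matrix[OF R])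
  moreover have "(\<Sum>i\<in>UNIV. P i j) = 1" for j
    by (simp add: P_def inner_commute[of "column j Q"] sum_inner_columns_squared[OF R]
        inner_columns_orthogonal_matrix[OF Q])
  ultimately obtain p where p: "p permutes UNIV"
    "(\<Sum>i\<in>UNIV. \<Sum>j\<in>UNIV. s $ i * y $ j * P i j) \<le> (\<Sum>i\<in>UNIV. s $ i * y $ p i)"
    using doubly_stochastic_le_permutation[of P "($) s" "($) y"] by (auto simp: P_def)
  have "frob (R ** diag_mat s ** transpose R) (Q ** diag_mat a ** transpose Q) =
      (\<Sum>i\<in>UNIV. \<Sum>j\<in>UNIV. s $ i * a $ j * P i j)"
    by (simp add: frob_conj_diag quadratic_form_conj_diag P_def sum_distrib_left mult.assoc)
  also have "\<dots> \<ge> (\<Sum>i\<in>UNIV. \<Sum>j\<in>UNIV. s $ i * (- y $ j) * P i j)"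
    using s y by (intro sum_mono mult_right_mono mult_left_mono) (auto simp: P_def)
  finally show ?thesis using p by (auto simp: sum_negf)
qed

lemma frob_conj_diag_same:
  fixes Q :: "real ^ 'n ^ 'n"
  assumes "orthogonal_matrix Q"
  shows "frob (Q ** diag_mat s ** transpose Q) (Q ** diag_mat a ** transpose Q) = s \<bullet> a"
  unfolding frob_conj_diag quadratic_form_conj_diag inner_columns_orthogonal_matrix[OF assms]
  by (simp add: inner_vec_def if_distrib[of "\<lambda>x. x\<^sup>2"] if_distrib[of "\<lambda>x. _ * x"] cong: if_cong)

section \<open>Symmetric gauges\<close>

lemma trun_nth: "trun I z $ i = (if i \<in> I then z $ i else 0)"
proof -
  have "trun I z $ i = (\<Sum>j\<in>I. if i = j then z $ j else 0)"
    unfolding trun_def sum_component by (intro sum.cong) (auto simp: axis_def)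
  then show ?thesis by simp
qed

lemma inner_trun_commute: "trun I y \<bullet> z = y \<bullet> trun I z"
  by (auto simp: inner_vec_def trun_nth intro: sum.cong)

lemma trun_id: "supp z \<subseteq> I \<Longrightarrow> trun I z = z"
  by (auto simp: vec_eq_iff trun_nth supp_def)

context
  fixes \<phi> :: "real ^ 'n \<Rightarrow> real"
  assumes sg: "symmetric_gauge \<phi>"
begin

lemma gauge_nonneg: "0 \<le> \<phi> z"
  and gauge_eq_0_iff: "\<phi> z = 0 \<longleftrightarrow> z = 0"
  and gauge_scale: "\<phi> (c *\<^sub>R z) = \<bar>c\<bar> * \<phi> z"
  and gauge_triangle: "\<phi> (x + z) \<le> \<phi> x + \<phi> z"
  and gauge_abs: "\<phi> (\<chi> i. \<bar>z $ i\<bar>) = \<phi> z"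
  and gauge_permute: "p permutes UNIV \<Longrightarrow> \<phi> (\<chi> i. z $ p i) = \<phi> z"
  using sg unfolding symmetric_gauge_def is_norm_def by auto

lemma gauge_trun_le: "\<phi> (trun I z) \<le> \<phi> z"
proof -
  \<comment> \<open>Deleting coordinates is averaging with a sign change, and sign changes preserve \<open>\<phi>\<close>.\<close>
  define w where "w = (\<chi> i. if i \<in> I then z $ i else - z $ i)"
  have "(\<chi> i. \<bar>w $ i\<bar>) = (\<chi> i. \<bar>z $ i\<bar>)" by (simp add: w_def vec_eq_iff)
  then have "\<phi> w = \<phi> z" using gauge_abs by metis
  moreover have "trun I z = (1 / 2) *\<^sub>R (z + w)"
    by (simp add: vec_eq_iff trun_nth w_def)
  ultimately show ?thesis using gauge_triangle[of z w] by (simp add: gauge_scale)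
qed

lemma compact_gauge_ball: "compact {z. \<phi> z \<le> 1}"
proof (rule compact_eq_bounded_closed[THEN iffD2], rule conjI)
  define C where "C = (\<Sum>i\<in>UNIV. 1 / \<phi> (axis i 1))"
  have "norm z \<le> C" if "\<phi> z \<le> 1" for z
  proof -
    have "\<bar>z $ i\<bar> \<le> 1 / \<phi> (axis i 1)" for i
    proof -
      have "\<bar>z $ i\<bar> * \<phi> (axis i 1) \<le> 1"
        using gauge_trun_le[of "{i}" z] that by (simp add: trun_def gauge_scale)
      moreover have "0 < \<phi> (axis i 1)"
        using gauge_nonneg[of "axis i 1"] gauge_eq_0_iff[of "axis i 1"]
        by (simp add: less_le axis_eq_0_iff)
      ultimately show ?thesis by (simp add: field_simps)
    qed
    then have "(\<Sum>i\<in>UNIV. \<bar>z $ i\<bar>) \<le> C" unfolding C_def by (rule sum_mono)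
    with norm_le_l1_cart[of z] show ?thesis by simp
  qed
  then show "bounded {z. \<phi> z \<le> 1}" by (auto simp: bounded_iff)
  have "convex_on UNIV \<phi>"
  proof (rule convex_onI)
    fix t :: real and x y :: "real ^ 'n"
    assume "0 < t" "t < 1"
    then show "\<phi> ((1 - t) *\<^sub>R x + t *\<^sub>R y) \<le> (1 - t) * \<phi> x + t * \<phi> y"
      using gauge_triangle[of "(1 - t) *\<^sub>R x" "t *\<^sub>R y"] by (simp add: gauge_scale)
  qed simp
  then have "continuous_on UNIV \<phi>" by (intro convex_on_continuous) auto
  then show "closed {z. \<phi> z \<le> 1}" by (intro closed_Collect_le continuous_intros)
qed

text \<open>
  Replacing a vector by its absolute value and deleting the coordinates where \<open>w\<close> vanishes keeps
  it in the ball and does not decrease the pairing with \<open>w \<ge> 0\<close>. Hence the maximum over the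
  restricted set is already the dual norm of \<open>w\<close>.
\<close>

lemma gauge_ball_argmax:
  assumes w: "0 \<le> w"
  shows "\<exists>z. is_arg_max (\<lambda>z. w \<bullet> z) (\<lambda>z. 0 \<le> z \<and> \<phi> z \<le> 1 \<and> supp z \<subseteq> supp w) z \<and>
    (\<forall>x. \<phi> x \<le> 1 \<longrightarrow> \<bar>w \<bullet> x\<bar> \<le> w \<bullet> z)"
proof -
  let ?F = "{z. \<phi> z \<le> 1} \<inter> {z. 0 \<le> z \<and> supp z \<subseteq> supp w}"
  have "{z. 0 \<le> z \<and> supp z \<subseteq> supp w} =
      (\<Inter>i. {z. 0 \<le> z $ i} \<inter> {z. w $ i = 0 \<longrightarrow> z $ i = 0})"
    by (auto simp: less_eq_vec_def supp_def)
  moreover have "closed ({z :: real ^ 'n. 0 \<le> z $ i} \<inter> {z. w $ i = 0 \<longrightarrow> z $ i = 0})" for i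
  proof -
    have "closed {z :: real ^ 'n. 0 \<le> z $ i}" by (rule closed_halfspace_component_ge_cart)
    moreover have "closed {z :: real ^ 'n. z $ i = 0}"
      by (intro closed_Collect_eq continuous_intros)
    ultimately show ?thesis
      by (cases "w $ i = 0") (simp_all add: closed_Int)
  qed
  ultimately have "closed {z. 0 \<le> z \<and> supp z \<subseteq> supp w}" by (auto intro: closed_INT)
  then have "compact ?F" by (rule compact_Int_closed[OF compact_gauge_ball])
  moreover have "0 \<in> ?F" by (simp add: gauge_eq_0_iff[THEN iffD2] supp_def)
  then have "?F \<noteq> {}" by blast
  moreover have "continuous_on ?F (\<lambda>z. w \<bullet> z)" by (intro continuous_intros)
  ultimately have "\<exists>z\<in>?F. \<forall>x\<in>?F. w \<bullet> x \<le> w \<bullet> z" by (rule continuous_attains_sup)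
  then obtain z where z: "z \<in> ?F" and zmax: "\<And>x. x \<in> ?F \<Longrightarrow> w \<bullet> x \<le> w \<bullet> z" by blast
  have "\<bar>w \<bullet> x\<bar> \<le> w \<bullet> z" if x: "\<phi> x \<le> 1" for x
  proof -
    define x' where "x' = trun (supp w) (\<chi> i. \<bar>x $ i\<bar>)"
    have "\<phi> x' \<le> 1"
      using gauge_trun_le[of "supp w" "\<chi> i. \<bar>x $ i\<bar>"] x by (simp add: x'_def gauge_abs)
    then have "x' \<in> ?F" by (auto simp: x'_def less_eq_vec_def trun_nth supp_def)
    have "\<bar>w \<bullet> x\<bar> \<le> (\<Sum>i\<in>UNIV. \<bar>w $ i * x $ i\<bar>)" by (simp add: inner_vec_def sum_abs)
    also have "\<dots> = w \<bullet> x'"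
      using w by (auto simp: inner_vec_def x'_def trun_nth supp_def abs_mult less_eq_vec_def intro!: sum.cong)
    also have "\<dots> \<le> w \<bullet> z" by (rule zmax[OF \<open>x' \<in> ?F\<close>])
    finally show ?thesis .
  qed
  then show ?thesis using z zmax by (intro exI[of _ z]) (auto simp: is_arg_max_linorder)
qed

section \<open>The rank gauge\<close>

lemma rank_gauge_le_1:
  assumes "u \<in> sparse_ball k \<phi>"
  shows "rank_gauge k \<phi> u \<le> 1"
  unfolding rank_gauge_def
proof (rule cInf_lower)
  show "1 \<in> {t. 0 < t \<and> u \<in> (\<lambda>u. t *\<^sub>R u) ` (convex hull sparse_ball k \<phi>)}"
    using hull_inc[OF assms, of convex] by simp
  show "bdd_below {t. 0 < t \<and> u \<in> (\<lambda>u. t *\<^sub>R u) ` (convex hull sparse_ball k \<phi>)}"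
    by (rule bdd_belowI[of _ 0]) simp
qed

text \<open>
  The rank gauge is an infimum, which is meaningful only over a nonempty set. The vectors for which
  the set is nonempty are closed under addition, since the hull is convex, and contain the
  multiples of the coordinate vectors, which are \<open>1\<close>-sparse.
\<close>

lemma sparse_hull_absorbing:
  assumes "1 \<le> k"
  shows "\<exists>t>0. z \<in> (\<lambda>u. t *\<^sub>R u) ` (convex hull sparse_ball k \<phi>)"
proof -
  let ?K = "convex hull sparse_ball k \<phi>"
  let ?N = "{z. \<exists>t>0. z \<in> (\<lambda>u. t *\<^sub>R u) ` ?K}"
  have add: "x + y \<in> ?N" if xy: "x \<in> ?N" "y \<in> ?N" for x y
  proof -
    obtain s u t v where st: "s > 0" "t > 0" "u \<in> ?K" "v \<in> ?K" "x = s *\<^sub>R u" "y = t *\<^sub>R v"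
      using xy by blast
    then have "(s / (s + t)) *\<^sub>R u + (t / (s + t)) *\<^sub>R v \<in> ?K"
      by (intro convexD convex_convex_hull) (auto simp flip: add_divide_distrib)
    moreover have "x + y = (s + t) *\<^sub>R ((s / (s + t)) *\<^sub>R u + (t / (s + t)) *\<^sub>R v)"
      using st by (simp add: scaleR_add_right)
    ultimately show ?thesis using st by (auto intro!: exI[of _ "s + t"])
  qed
  have axis: "z $ i *\<^sub>R axis i 1 \<in> ?N" for i
  proof -
    define t where "t = \<bar>z $ i\<bar> * \<phi> (axis i 1) + 1"
    have t: "t > 0" using gauge_nonneg[of "axis i 1"] by (simp add: t_def add_nonneg_pos)
    define u where "u = (z $ i / t) *\<^sub>R (axis i 1 :: real ^ 'n)"
    have "\<phi> u \<le> 1" using t by (simp add: u_def gauge_scale) (simp add: t_def)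
    moreover have "supp u \<subseteq> {i}" by (auto simp: supp_def u_def axis_def)
    then have "card (supp u) \<le> k" using card_mono[of "{i}" "supp u"] assms by simp
    ultimately have "u \<in> ?K" by (auto simp: sparse_ball_def intro: hull_inc)
    moreover have "z $ i *\<^sub>R axis i 1 = t *\<^sub>R u" using t by (simp add: u_def)
    ultimately show ?thesis using t by blast
  qed
  have zero: "0 \<in> ?N"
  proof -
    have "0 \<in> ?K"
      by (rule hull_inc) (simp add: sparse_ball_def supp_def gauge_eq_0_iff[THEN iffD2])
    then show ?thesis by (auto intro!: exI[of _ 1] image_eqI[of _ _ 0])
  qed
  have "trun A z \<in> ?N" if "finite A" for A
    unfolding trun_def using that
  proof (induction A)
    case (insert i A)
    then show ?case using add[OF axis] by (simp del: mem_Collect_eq)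
  qed (use zero in simp)
  from this[of UNIV] show ?thesis by (simp add: trun_id)
qed

text \<open>
  This passes from sparse vectors to the rank gauge without showing that its unit ball is the
  convex hull, which would need closedness of the hull: a bound on the sparse ball extends to the hull, is
  scaled by \<open>t\<close>, and survives taking the infimum over \<open>t\<close>.
\<close>

lemma abs_inner_le_rank_gauge:
  assumes k: "1 \<le> k" and bound: "\<And>u. u \<in> sparse_ball k \<phi> \<Longrightarrow> \<bar>w \<bullet> u\<bar> \<le> M"
  shows "\<bar>w \<bullet> z\<bar> \<le> M * rank_gauge k \<phi> z"
proof -
  let ?K = "convex hull sparse_ball k \<phi>"
  let ?T = "{t. 0 < t \<and> z \<in> (\<lambda>u. t *\<^sub>R u) ` ?K}"
  have ne: "?T \<noteq> {}" using sparse_hull_absorbing[OF k, of z] by blast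
  have hull: "\<bar>w \<bullet> u\<bar> \<le> M" if "u \<in> ?K" for u
  proof -
    have "convex {u. \<bar>w \<bullet> u\<bar> \<le> M}"
    proof -
      have "{u. \<bar>w \<bullet> u\<bar> \<le> M} = {u. w \<bullet> u \<le> M} \<inter> {u. w \<bullet> u \<ge> - M}" by auto
      then show ?thesis by (simp add: convex_Int convex_halfspace_le convex_halfspace_ge)
    qed
    with bound have "?K \<subseteq> {u. \<bar>w \<bullet> u\<bar> \<le> M}" by (intro hull_minimal) auto
    with that show ?thesis by blast
  qed
  have le: "\<bar>w \<bullet> z\<bar> \<le> M * t" if "t \<in> ?T" for t
  proof -
    obtain u where "u \<in> ?K" "z = t *\<^sub>R u" "t > 0" using \<open>t \<in> ?T\<close> by blast
    then show ?thesis using hull[of u] by (simp add: abs_mult mult.commute)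
  qed
  have M: "0 \<le> M"
    using bound[of 0] by (simp add: sparse_ball_def supp_def gauge_eq_0_iff[THEN iffD2])
  show ?thesis
  proof (cases "M = 0")
    case True
    then show ?thesis using le ne by auto
  next
    case False
    then have "\<bar>w \<bullet> z\<bar> / M \<le> Inf ?T"
      using M le by (intro cInf_greatest[OF ne]) (simp add: field_simps)
    then show ?thesis using M False by (simp add: rank_gauge_def field_simps)
  qed
qed

text \<open>
  Swap an index of the support outside \<open>I\<close> with an index of \<open>I\<close> outside the support, which
  exists because the support has at most as many elements as \<open>I\<close>. The swap moves mass to an entry
  of \<open>y\<close> that is at least as large, and brings one more index of the support into \<open>I\<close>.
\<close>

lemma move_support_into_top_index_set:
  assumes top: "top_index_set k y I" and y: "\<forall>i. 0 \<le> y $ i"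
  shows "\<forall>i. 0 \<le> u $ i \<Longrightarrow> card (supp u) \<le> k \<Longrightarrow>
    \<exists>u'. \<phi> u' = \<phi> u \<and> supp u' \<subseteq> I \<and> y \<bullet> u \<le> y \<bullet> u'"
proof (induction "card (supp u - I)" arbitrary: u rule: less_induct)
  case less
  show ?case
  proof (cases "supp u \<subseteq> I")
    case False
    then obtain j where j: "j \<in> supp u" "j \<notin> I" by blast
    have "\<not> I \<subseteq> supp u"
    proof
      assume "I \<subseteq> supp u"
      then have "card I < card (supp u)" using j by (intro psubset_card_mono) auto
      with less.prems top show False by (simp add: top_index_set_def)
    qed
    then obtain i where i: "i \<in> I" "i \<notin> supp u" by blast
    define p where "p = Transposition.transpose i j"
    have p: "p permutes UNIV" by (simp add: p_def permutes_swap_id)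
    define v where "v = (\<chi> l. u $ p l)"
    have v: "v $ i = u $ j" "v $ j = 0" "\<And>l. l \<noteq> i \<Longrightarrow> l \<noteq> j \<Longrightarrow> v $ l = u $ l"
      using i by (auto simp: v_def p_def supp_def Transposition.transpose_def)
    have supp_v: "supp v = insert i (supp u - {j})"
      using v i j by (auto simp: supp_def) (metis)+
    have "card (supp v - I) < card (supp u - I)"
      using i j by (intro psubset_card_mono) (auto simp: supp_v)
    moreover have "card (supp v) \<le> k"
      using less.prems i j card_Suc_Diff1[of "supp u" j] by (simp add: supp_v)
    moreover have "\<forall>l. 0 \<le> v $ l" using less.prems by (simp add: v_def)
    ultimately obtain u' where u': "\<phi> u' = \<phi> v" "supp u' \<subseteq> I" "y \<bullet> v \<le> y \<bullet> u'"
      using less.hyps by blast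
    have "y \<bullet> v - y \<bullet> u = (\<Sum>l\<in>UNIV. y $ l * (v $ l - u $ l))"
      by (simp add: inner_vec_def right_diff_distrib sum_subtractf)
    also have "\<dots> = (\<Sum>l\<in>{i, j}. y $ l * (v $ l - u $ l))"
      using v(3) by (intro sum.mono_neutral_right) auto
    also have "\<dots> = (y $ i - y $ j) * u $ j"
      using i j v by (subst sum.insert) (auto simp: supp_def algebra_simps)
    also have "\<dots> \<ge> 0"
      using top y i j less.prems by (intro mult_nonneg_nonneg) (auto simp: top_index_set_def)
    finally show ?thesis
      using u' gauge_permute[OF p, of u] by (intro exI[of _ u']) (auto simp: v_def)
  qed auto
qed

text \<open>
  The permutation is moved from \<open>y\<close> to \<open>u\<close>, where it changes neither the gauge nor the sparsity;
  then the support is moved into \<open>I\<close>, where \<open>y\<close> and its truncation agree.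
\<close>

lemma abs_inner_permuted_sparse_le:
  assumes top: "top_index_set k y I" and y: "\<forall>i. 0 \<le> y $ i"
    and M: "\<And>x. \<phi> x \<le> 1 \<Longrightarrow> \<bar>trun I y \<bullet> x\<bar> \<le> M"
    and p: "p permutes UNIV" and u: "u \<in> sparse_ball k \<phi>"
  shows "\<bar>(\<chi> i. y $ p i) \<bullet> u\<bar> \<le> M"
proof -
  define v where "v = (\<chi> i. \<bar>u $ inv p i\<bar>)"
  have "\<phi> v = \<phi> (\<chi> i. u $ inv p i)" using gauge_abs[of "\<chi> i. u $ inv p i"] by (simp add: v_def)
  also have "\<dots> \<le> 1"
    using gauge_permute[OF permutes_inv[OF p], of u] u by (simp add: sparse_ball_def)
  finally have "\<phi> v \<le> 1" .
  moreover have "card (supp v) \<le> k"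
  proof -
    have "supp v \<subseteq> p ` supp u"
      using permutes_inverses(1)[OF p] by (auto simp: supp_def v_def image_iff) metis
    then have "card (supp v) \<le> card (supp u)" by (rule surj_card_le[OF finite])
    then show ?thesis using u by (simp add: sparse_ball_def)
  qed
  ultimately obtain u' where u': "\<phi> u' \<le> 1" "supp u' \<subseteq> I" "y \<bullet> v \<le> y \<bullet> u'"
    using move_support_into_top_index_set[OF top y, of v] by (auto simp: v_def) metis
  have "\<bar>(\<chi> i. y $ p i) \<bullet> u\<bar> \<le> (\<Sum>i\<in>UNIV. \<bar>y $ p i * u $ i\<bar>)"
    by (simp add: inner_vec_def sum_abs)
  also have "\<dots> = (\<Sum>i\<in>UNIV. \<bar>y $ i * u $ inv p i\<bar>)"
    using sum.permute[OF p, of "\<lambda>i. \<bar>y $ i * u $ inv p i\<bar>"] permutes_inverses(2)[OF p]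
    by (simp add: comp_def)
  also have "\<dots> = y \<bullet> v" using y by (simp add: inner_vec_def v_def abs_mult)
  also have "\<dots> \<le> y \<bullet> u'" by (rule u')
  also have "\<dots> = trun I y \<bullet> u'" by (simp add: inner_trun_commute trun_id[OF u'(2)])
  also have "\<dots> \<le> M" using M[OF u'(1)] by simp
  finally show ?thesis .
qed

end

lemma dual_norm_eqI:
  assumes "\<And>x. \<psi> x \<le> 1 \<Longrightarrow> \<bar>y \<bullet> x\<bar> \<le> y \<bullet> z" and "\<psi> z \<le> 1"
  shows "dual_norm \<psi> y = y \<bullet> z"
  unfolding dual_norm_def
proof (rule Greatest_equality)
  have "\<bar>y \<bullet> z\<bar> = y \<bullet> z" using assms(1)[OF assms(2)] by linarith
  then show "y \<bullet> z \<in> {\<bar>y \<bullet> z\<bar> |z. \<psi> z \<le> 1}" using assms(2) by force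
qed (use assms in auto)

section \<open>Optimal rank-constrained separators\<close>

theorem theorem4p10:
  fixes \<phi> :: "real ^ 'n::{finite,linorder} \<Rightarrow> real"
    and k :: nat
    and X Q :: "real ^ 'n::{finite,linorder} ^ 'n::{finite,linorder}"
    and I :: "'n::{finite,linorder} set"
  assumes "symmetric_gauge \<phi>"
    and "1 \<le> k" and "k \<le> CARD('n)"
    and "X \<in> sym_mats"
    and "orthogonal_matrix Q"
    and "X = Q ** diag_mat (eigvals X) ** transpose Q"
    and "top_index_set k (eigvals_neg X) I"
  shows "sep_value (rank_gauge k \<phi>) X = - dual_norm (rank_gauge k \<phi>) (eigvals_neg X)
    \<and> - dual_norm (rank_gauge k \<phi>) (eigvals_neg X) = - dual_norm \<phi> (trun I (eigvals_neg X))
    \<and> (\<exists>S z. S = Q ** diag_mat z ** transpose Q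
        \<and> optimal_separator (rank_gauge k \<phi>) X S
        \<and> is_arg_max (\<lambda>z. trun I (eigvals_neg X) \<bullet> z)
            (\<lambda>z. 0 \<le> z \<and> \<phi> z \<le> 1 \<and> supp z \<subseteq> supp (trun I (eigvals_neg X))) z
        \<and> rank S \<le> k
        \<and> (X \<notin> psd_cone \<longrightarrow> frob S X < 0 \<and> (\<forall>Y\<in>psd_cone. 0 \<le> frob S Y)))"
proof -
  note sg = assms(1) and k = assms(2) and Q = assms(5) and X = assms(6)
  define a where "a = eigvals X"
  define y where "y = eigvals_neg X"
  define w where "w = trun I y"
  let ?\<psi> = "rank_gauge k \<phi>"
  let ?F = "psd_cone \<inter> spectral_ball ?\<psi>"
  have y_nth: "y $ i = max (- a $ i) 0" for i by (simp add: y_def a_def eigvals_neg_def)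
  have y: "\<forall>i. 0 \<le> y $ i" and ya: "\<forall>i. - y $ i \<le> a $ i" by (auto simp: y_nth)
  have Xa: "X = Q ** diag_mat a ** transpose Q" using X by (simp add: a_def)
  have top: "top_index_set k y I" using assms(7) by (simp add: y_def)
  have w: "0 \<le> w" using y by (simp add: w_def less_eq_vec_def trun_nth)
  obtain z where argmax: "is_arg_max (\<lambda>z. w \<bullet> z) (\<lambda>z. 0 \<le> z \<and> \<phi> z \<le> 1 \<and> supp z \<subseteq> supp w) z"
    and zmax: "\<And>x. \<phi> x \<le> 1 \<Longrightarrow> \<bar>w \<bullet> x\<bar> \<le> w \<bullet> z"
    using gauge_ball_argmax[OF sg w] by blast
  then have z: "\<forall>i. 0 \<le> z $ i" "\<phi> z \<le> 1" "supp z \<subseteq> supp w"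
    by (auto simp: is_arg_max_def less_eq_vec_def)
  have "supp w \<subseteq> I" by (auto simp: w_def supp_def trun_nth)
  with z(3) have zI: "supp z \<subseteq> I" by blast
  then have card_z: "card (supp z) \<le> k"
    using top card_mono[of I "supp z"] by (simp add: top_index_set_def)
  have z_sparse: "z \<in> sparse_ball k \<phi>" using z card_z by (simp add: sparse_ball_def)
  have yz: "y \<bullet> z = w \<bullet> z" by (simp add: w_def inner_trun_commute trun_id[OF zI])
  have M: "0 \<le> w \<bullet> z" using zmax[OF z(2)] by linarith

  have bound: "\<bar>(\<chi> i. y $ p i) \<bullet> x\<bar> \<le> w \<bullet> z"
    if p: "p permutes UNIV" and x: "?\<psi> x \<le> 1" for p x
  proof -
    have "\<bar>(\<chi> i. y $ p i) \<bullet> x\<bar> \<le> (w \<bullet> z) * ?\<psi> x"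
      using zmax p by (intro abs_inner_le_rank_gauge[OF sg k] abs_inner_permuted_sparse_le[OF sg top y])
        (auto simp: w_def)
    also have "\<dots> \<le> (w \<bullet> z) * 1" using M x by (intro mult_left_mono) auto
    finally show ?thesis by simp
  qed
  have dual_rank: "dual_norm ?\<psi> y = w \<bullet> z"
    unfolding yz[symmetric]
    using bound[OF permutes_id] rank_gauge_le_1[OF sg z_sparse]
    by (intro dual_norm_eqI) (simp_all add: yz)
  have dual_trun: "dual_norm \<phi> w = w \<bullet> z"
    using zmax z(2) by (intro dual_norm_eqI)

  have lower: "- (w \<bullet> z) \<le> frob S X" if "S \<in> ?F" for S
  proof -
    have S: "S \<in> psd_cone" "S \<in> sym_mats" "?\<psi> (eigvals S) \<le> 1"
      using that by (auto simp: spectral_ball_def)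
    obtain R d p where R: "orthogonal_matrix R" "S = R ** diag_mat d ** transpose R"
      and p: "p permutes UNIV" "eigvals S = (\<chi> i. d $ p i)"
      using spectral_decomposition_eigvals[OF S(2)] by blast
    have "\<forall>i. 0 \<le> d $ i" using S(1) conj_diag_in_psd_cone_iff[OF R(1)] R(2) by simp
    then obtain q where q: "q permutes UNIV" "- (\<Sum>i\<in>UNIV. d $ i * y $ q i) \<le> frob S X"
      using frob_conj_diag_ge[OF R(1) Q _ ya] unfolding R(2) Xa by blast
    have "(\<Sum>i\<in>UNIV. d $ i * y $ q i) = (\<Sum>i\<in>UNIV. d $ p i * y $ q (p i))"
      using sum.permute[OF p(1), of "\<lambda>i. d $ i * y $ q i"] by (simp add: comp_def)
    also have "\<dots> = (\<chi> i. y $ (q \<circ> p) i) \<bullet> eigvals S"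
      by (simp add: p(2) inner_vec_def mult.commute)
    also have "\<dots> \<le> w \<bullet> z"
      using bound[OF permutes_compose[OF p(1) q(1)] S(3)] by simp
    finally show ?thesis using q(2) by simp
  qed

  define S where "S = Q ** diag_mat z ** transpose Q"
  have S_psd: "S \<in> psd_cone" unfolding S_def using conj_diag_in_psd_cone_iff[OF Q] z(1) by blast
  have S_feasible: "S \<in> ?F"
  proof -
    obtain p where p: "p permutes UNIV" "eigvals S = (\<chi> i. z $ p i)"
      unfolding S_def using eigvals_conj_diag[OF Q] by blast
    have "supp (\<chi> i. z $ p i) \<subseteq> inv p ` supp z"
      using permutes_inverses(2)[OF p(1)] by (auto simp: supp_def image_iff) metis
    then have "card (supp (\<chi> i. z $ p i)) \<le> card (supp z)" by (rule surj_card_le[OF finite])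
    then have "(\<chi> i. z $ p i) \<in> sparse_ball k \<phi>"
      using z(2) card_z by (simp add: sparse_ball_def gauge_permute[OF sg p(1)])
    then have "?\<psi> (eigvals S) \<le> 1" using rank_gauge_le_1[OF sg] p(2) by simp
    then show ?thesis using S_psd by (simp add: spectral_ball_def psd_cone_def)
  qed
  have S_value: "frob S X = - (w \<bullet> z)"
  proof -
    have "z $ i * a $ i = - (y $ i * z $ i)" for i
    proof (cases "z $ i = 0")
      case False
      then have "w $ i \<noteq> 0" using z(3) by (auto simp: supp_def)
      then have "a $ i = - y $ i"
        by (simp add: w_def trun_nth y_nth max_def split: if_splits)
      then show ?thesis by simp
    qed simp
    then have "z \<bullet> a = - (y \<bullet> z)" by (simp add: inner_vec_def sum_negf)
    then show ?thesis unfolding S_def Xa frob_conj_diag_same[OF Q] by (simp add: yz)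
  qed
  have sep_value: "sep_value ?\<psi> X = - (w \<bullet> z)"
    unfolding sep_value_def
  proof (rule Least_equality)
    show "- (w \<bullet> z) \<in> {frob S X |S. S \<in> ?F}" using S_feasible S_value by (metis (mono_tags, lifting) mem_Collect_eq)
  qed (use lower in auto)
  have optimal: "optimal_separator ?\<psi> X S"
    using S_feasible lower S_value by (auto simp: optimal_separator_def is_arg_min_linorder)
  have negative: "frob S X < 0" if "X \<notin> psd_cone"
  proof -
    have "\<not> (\<forall>i. 0 \<le> a $ i)"
      using that conj_diag_in_psd_cone_iff[OF Q, of a] unfolding Xa by blast
    then obtain j where "a $ j < 0" by (auto simp: not_le)
    then have j: "0 < y $ j" by (simp add: y_nth)
    have "\<exists>i\<in>I. 0 < y $ i"
    proof (cases "j \<in> I")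
      case False
      have "I \<noteq> {}" using top k by (auto simp: top_index_set_def)
      then obtain i where "i \<in> I" by blast
      then have "y $ j \<le> y $ i" using top False y by (auto simp: top_index_set_def)
      with j \<open>i \<in> I\<close> show ?thesis by (auto intro: less_le_trans)
    qed (use j in blast)
    then have "w \<noteq> 0" by (auto simp: w_def vec_eq_iff trun_nth less_le)
    then have pos: "0 < w \<bullet> w" and \<phi>w: "0 < \<phi> w"
      using gauge_nonneg[OF sg, of w] gauge_eq_0_iff[OF sg, of w] by (simp_all add: less_le)
    have "\<phi> ((1 / \<phi> w) *\<^sub>R w) \<le> 1" using \<phi>w by (simp add: gauge_scale[OF sg])
    \<comment> \<open>Testing the maximum with \<open>w\<close> itself, scaled into the ball, shows that it is positive.\<close>
    from zmax[OF this] pos \<phi>w have "0 < w \<bullet> z"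
      by (smt (verit) divide_pos_pos inner_scaleR_right mult_pos_pos zero_less_one)
    then show ?thesis by (simp add: S_value)
  qed
  have "rank S \<le> k" unfolding S_def using rank_conj_diag_le card_z by (rule order_trans)
  moreover have "\<forall>Y\<in>psd_cone. 0 \<le> frob S Y" unfolding S_def using frob_psd_nonneg z(1) by blast
  ultimately show ?thesis
    using sep_value dual_rank dual_trun optimal argmax negative S_def
    unfolding y_def[symmetric] w_def[symmetric] by auto
qed

end
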